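(* Let $E\subsetneq\mathbb{R}^n$ be a closed unbounded convex set with bounded convex exhaustion hulls (BCEH). Then: (i) $E$ does not contain any affine real line; (ii) for every affine line $\ell$ intersecting $E$ in a ray and any affine hyperplane $H\subset\mathbb{R}^n$ transverse to $\ell$, $E$ is the epigraph of a convex function on $H$. In particular, there are affine coordinates $(x,y)\in\mathbb{R}^{n-1}\times\mathbb{R}$ on $\mathbb{R}^n$ in which $$E=\{(x,y)\in\mathbb{R}^{n-1}\times\mathbb{R}: y\ge\phi(x)\}$$ for a convex function $\phi:\mathbb{R}^{n-1}\to[0,+\infty)$ satisfying $$\liminf_{|x|\to+\infty}\frac{\phi(x)}{|x|}>0.$$
   Context: A closed convex set $E\subset\mathbb{R}^n$ has bounded convex exhaustion hulls (BCEH) if for every compact convex set $K\subset\mathbb{R}^n$ the set $h(E,K)=\mathrm{Conv}(E\cup K)\setminus E$ is bounded, where $\mathrm{Conv}$ denotes the convex hull. A ray is a closed affine halfline. If $\ell$ meets $E$ in a ray with direction vector $v$ (pointing along the ray to infinity) and $H$ is transverse to $\ell$, then "$E$ is the epigraph of a convex function on $H$" means that there is a convex function $\phi:H\to\mathbb{R}$ with $E=\{x+yv: x\in H,\ y\in\mathbb{R},\ y\ge\phi(x)\}$. *)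

theory Defs
  imports "HOL-Analysis.Analysis"
begin

text \<open>Bounded convex exhaustion hulls. Closedness and convexity of \<open>E\<close> are assumed separately.\<close>

definition bceh :: "'a::euclidean_space set \<Rightarrow> bool" where
  "bceh E \<longleftrightarrow> (\<forall>K. compact K \<and> convex K \<longrightarrow> bounded (convex hull (E \<union> K) - E))"

definition affine_line :: "'a::euclidean_space set \<Rightarrow> bool" where
  "affine_line L \<longleftrightarrow> affine L \<and> aff_dim L = 1"

definition affine_hyperplane :: "'a::euclidean_space set \<Rightarrow> bool" where
  "affine_hyperplane H \<longleftrightarrow> affine H \<and> aff_dim H = int DIM('a) - 1"

definition ray :: "'a::real_vector \<Rightarrow> 'a \<Rightarrow> 'a set" where
  "ray a v = {a + t *\<^sub>R v | t. 0 \<le> t}"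

text \<open>Affine subspaces are transverse when their directions together span the whole space.\<close>

definition transverse :: "'a::real_vector set \<Rightarrow> 'a set \<Rightarrow> bool" where
  "transverse L H \<longleftrightarrow>
     span ({p - q | p q. p \<in> L \<and> q \<in> L} \<union> {p - q | p q. p \<in> H \<and> q \<in> H}) = UNIV"

text \<open>Only the values of \<open>\<phi>\<close> on \<open>H\<close> matter.\<close>

definition epigraph_on :: "'a::real_vector set \<Rightarrow> 'a \<Rightarrow> 'a set \<Rightarrow> bool" where
  "epigraph_on H v E \<longleftrightarrow>
     (\<exists>\<phi>. convex_on H \<phi> \<and> E = {x + y *\<^sub>R v | x y. x \<in> H \<and> \<phi> x \<le> y})"

text \<open>
  The space of dimension \<open>n - 1\<close> is modelled as the coordinate hyperplane \<open>x $ k = 0\<close> in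
  \<open>real ^ 'n\<close>, with the induced Euclidean norm: its points are the tuples of the \<open>n - 1\<close>
  coordinates other than the \<open>k\<close>-th. A separate type \<open>real ^ 'm\<close> would exclude \<open>n = 1\<close>,
  since index types are nonempty.
\<close>

definition coord_hyperplane :: "'n::finite \<Rightarrow> (real ^ 'n) set" where
  "coord_hyperplane k = {x. x $ k = 0}"

definition affine_coordinates :: "'n::finite \<Rightarrow> (real ^ 'n \<Rightarrow> (real ^ 'n) \<times> real) \<Rightarrow> bool" where
  "affine_coordinates k T \<longleftrightarrow>
     (\<exists>L c. linear L \<and> T = (\<lambda>z. c + L z)) \<and> bij_betw T UNIV (coord_hyperplane k \<times> UNIV)"

text \<open>
  The lower limit of \<open>\<phi> x / |x|\<close> as \<open>|x|\<close> tends to infinity with \<open>x \<in> S\<close>, as an extended real.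
  For bounded \<open>S\<close> (the case \<open>n = 1\<close>) it is \<open>\<infinity>\<close>.
\<close>

definition liminf_slope :: "'a::real_normed_vector set \<Rightarrow> ('a \<Rightarrow> real) \<Rightarrow> ereal" where
  "liminf_slope S \<phi> = Liminf (inf at_infinity (principal S)) (\<lambda>x. ereal (\<phi> x / norm x))"

end

theory Submission
  imports Defs
begin

text \<open>
  Everything rests on one observation. Let \<open>v \<noteq> 0\<close> be a recession direction of \<open>E\<close>, let \<open>a \<in> E\<close>,
  and let \<open>p\<close> be any point. In \<open>convex hull (E \<union> {2p - a})\<close> the midpoints of \<open>2p - a\<close> and the points
  \<open>a + 2tv\<close> of \<open>E\<close> are the points \<open>p + tv\<close>, for all \<open>t \<ge> 0\<close>. They form an unbounded set, so
  under BCEH some \<open>p + tv\<close> lies in \<open>E\<close>: every line parallel to \<open>v\<close> meets \<open>E\<close>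
  (\<open>bceh_line_meets\<close>). If \<open>-v\<close> were a recession direction as well, then \<open>E\<close> would contain all
  these lines and be the whole space; so the recession cone is pointed, and \<open>E\<close> contains no line
  (\<open>bceh_recession_cone_pointed\<close>, \<open>bceh_no_affine_line\<close>). Hence \<open>E\<close> meets each line parallel to
  \<open>v\<close> exactly in a closed half-line towards \<open>v\<close>. The starting parameter of this half-line is a
  convex function of the base point, which makes \<open>E\<close> an epigraph over every transverse hyperplane
  (\<open>lower_height_le_iff\<close>, \<open>bceh_epigraph_on\<close>).

  For the coordinates with linear growth, the unit vectors of the pointed closed recession cone
  form a compact set whose convex hull misses the origin. Separation gives a vector \<open>u\<close> with
  \<open>u \<bullet> d > b > 0\<close> for all unit recession directions \<open>d\<close>. Far points of \<open>E\<close> point almost in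
  recession directions, whence \<open>u \<bullet> z \<ge> b |z| - C\<close> on all of \<open>E\<close>
  (\<open>linear_growth_of_positive_functional\<close>). Taking \<open>u \<bullet> z + C\<close> as the vertical coordinate, and
  projecting along a recession direction onto the orthogonal complement of \<open>u\<close>, turns this bound
  into nonnegativity and a positive slope at infinity of the function whose epigraph \<open>E\<close> is.
\<close>

section \<open>Recession directions of closed convex sets\<close>

definition recession_cone :: "'a::real_vector set \<Rightarrow> 'a set" where
  "recession_cone E = {d. \<forall>x\<in>E. \<forall>t\<ge>0. x + t *\<^sub>R d \<in> E}"

lemma recession_coneD:
  "d \<in> recession_cone E \<Longrightarrow> x \<in> E \<Longrightarrow> 0 \<le> t \<Longrightarrow> x + t *\<^sub>R d \<in> E"
  unfolding recession_cone_def by blast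

lemma recession_cone_scaleR:
  assumes "d \<in> recession_cone E" and "0 \<le> c"
  shows "c *\<^sub>R d \<in> recession_cone E"
  using assms unfolding recession_cone_def by auto

lemma recession_cone_add:
  assumes "d \<in> recession_cone E" and "e \<in> recession_cone E"
  shows "d + e \<in> recession_cone E"
  using assms unfolding recession_cone_def
  by (simp add: scaleR_right_distrib add.assoc[symmetric])

lemma closed_recession_cone:
  fixes E :: "'a::real_normed_vector set"
  assumes "closed E"
  shows "closed (recession_cone E)"
proof -
  have "recession_cone E = (\<Inter>x\<in>E. \<Inter>t\<in>{0..}. (\<lambda>d. x + t *\<^sub>R d) -` E)"
    unfolding recession_cone_def by auto
  moreover have "closed ((\<lambda>d. x + t *\<^sub>R d) -` E)" for x t
    by (intro continuous_closed_vimage assms continuous_intros)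
  ultimately show ?thesis by (simp add: closed_INT)
qed

text \<open>
  For \<open>x \<in> E\<close> the point \<open>x + t (z n - x) / |z n|\<close> lies on the segment from \<open>x\<close> to \<open>z n\<close> once
  \<open>|z n| > t\<close>, and it tends to \<open>x + t d\<close> because the contribution of \<open>x / |z n|\<close> vanishes.
\<close>

lemma recession_cone_limit:
  fixes E :: "'a::real_normed_vector set"
  assumes "closed E" and "convex E"
    and z: "\<And>n. z n \<in> E" and inf: "filterlim (\<lambda>n. norm (z n)) at_top sequentially"
    and d: "(\<lambda>n. z n /\<^sub>R norm (z n)) \<longlonglongrightarrow> d"
  shows "d \<in> recession_cone E"
proof -
  have "x + t *\<^sub>R d \<in> E" if x: "x \<in> E" and t: "0 \<le> t" for x t
  proof -
    let ?s = "\<lambda>n. t * inverse (norm (z n))"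
    have s0: "?s \<longlonglongrightarrow> 0"
      using tendsto_mult_right_zero[OF tendsto_inverse_0_at_top[OF inf], of t] .
    have lim: "(\<lambda>n. x + t *\<^sub>R (z n /\<^sub>R norm (z n)) - ?s n *\<^sub>R x) \<longlonglongrightarrow> x + t *\<^sub>R d - 0 *\<^sub>R x"
      by (intro tendsto_intros d s0)
    have mem: "\<forall>\<^sub>F n in sequentially. x + t *\<^sub>R (z n /\<^sub>R norm (z n)) - ?s n *\<^sub>R x \<in> E"
    proof -
      have "\<forall>\<^sub>F n in sequentially. ?s n < 1"
        using order_tendstoD(2)[OF s0, of 1] by simp
      then show ?thesis
      proof eventually_elim
        case (elim n)
        have "(1 - ?s n) *\<^sub>R x + ?s n *\<^sub>R z n \<in> E"
          using elim t by (intro convexD[OF assms(2) x z]) auto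
        then show ?case by (simp add: algebra_simps)
      qed
    qed
    show ?thesis
      using Lim_in_closed_set[OF assms(1) mem sequentially_bot lim] by simp
  qed
  then show ?thesis unfolding recession_cone_def by blast
qed

text \<open>
  Compactness of the unit sphere supplies a limit direction. Recording that it is a limit of
  directions of points of \<open>S\<close> lets linear inequalities on \<open>S\<close> be passed on to a recession direction.
\<close>

lemma unbounded_subset_recession_direction:
  fixes E :: "'a::euclidean_space set"
  assumes "closed E" and "convex E" and "S \<subseteq> E" and "\<not> bounded S"
  obtains d where "d \<in> recession_cone E" and "norm d = 1"
    and "d \<in> closure ((\<lambda>z. z /\<^sub>R norm z) ` S)"
proof -
  have "\<exists>z\<in>S. real n < norm z" for n
    using assms(4) unfolding bounded_iff by (meson not_le)
  then obtain z where zS: "\<And>n. z n \<in> S" and zn: "\<And>n. real n < norm (z n)"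
    by metis
  have "z n \<noteq> 0" for n using zn[of n] by auto
  then have "\<forall>n. z n /\<^sub>R norm (z n) \<in> sphere 0 1" by simp
  then obtain d r where d: "d \<in> sphere 0 1" and r: "strict_mono r"
    and lim: "((\<lambda>n. z n /\<^sub>R norm (z n)) \<circ> r) \<longlonglongrightarrow> d"
    by (rule seq_compactE[OF compact_imp_seq_compact[OF compact_sphere]])
  have "filterlim (\<lambda>n. norm (z n)) at_top sequentially"
    by (rule filterlim_at_top_mono[OF filterlim_real_sequentially])
      (use zn in \<open>auto intro: always_eventually less_imp_le\<close>)
  then have "filterlim (\<lambda>n. norm (z (r n))) at_top sequentially"
    by (rule filterlim_compose[OF _ filterlim_subseq[OF r]])
  then have "d \<in> recession_cone E"
    using recession_cone_limit[OF assms(1,2), of "\<lambda>n. z (r n)"] zS assms(3) lim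
    by (auto simp: o_def)
  moreover have "d \<in> closure ((\<lambda>z. z /\<^sub>R norm z) ` S)"
    unfolding closure_sequential using lim zS
    by (intro exI[of _ "(\<lambda>n. z n /\<^sub>R norm (z n)) \<circ> r"]) simp
  ultimately show thesis using that d by simp
qed

text \<open>
  A single ray suffices: the segments from \<open>x\<close> to ever more distant points \<open>a + (t / s) v\<close> of the ray
  contain the points \<open>(1 - s) x + s a + t v\<close>, which converge to \<open>x + t v\<close> as \<open>s\<close> tends to \<open>0\<close>.
\<close>

lemma ray_imp_recession_direction:
  fixes E :: "'a::real_normed_vector set"
  assumes "closed E" and "convex E" and "ray a v \<subseteq> E"
  shows "v \<in> recession_cone E"
proof -
  have "x + t *\<^sub>R v \<in> E" if x: "x \<in> E" and t: "0 \<le> t" for x t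
  proof -
    let ?s = "\<lambda>n. inverse (real (Suc n))"
    have lim: "(\<lambda>n. x + t *\<^sub>R v + ?s n *\<^sub>R (a - x)) \<longlonglongrightarrow> x + t *\<^sub>R v + 0 *\<^sub>R (a - x)"
      by (intro tendsto_intros LIMSEQ_inverse_real_of_nat)
    have mem: "x + t *\<^sub>R v + ?s n *\<^sub>R (a - x) \<in> E" for n
    proof -
      have "a + (t * real (Suc n)) *\<^sub>R v \<in> E"
        using t by (intro subsetD[OF assms(3)]) (unfold ray_def, fastforce)
      then have "(1 - ?s n) *\<^sub>R x + ?s n *\<^sub>R (a + (t * real (Suc n)) *\<^sub>R v) \<in> E"
        by (intro convexD[OF assms(2) x]) (auto simp: field_simps)
      moreover have "?s n *\<^sub>R ((t * real (Suc n)) *\<^sub>R v) = t *\<^sub>R v" by simp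
      ultimately show ?thesis by (simp add: algebra_simps)
    qed
    show ?thesis using closed_sequentially[OF assms(1) mem lim] by simp
  qed
  then show ?thesis unfolding recession_cone_def by blast
qed

section \<open>Consequences of bounded convex exhaustion hulls\<close>

text \<open>
  BCEH enters with a single point as compact convex set. Adjoining \<open>p\<close> itself would
  only put the lines through points strictly between \<open>p\<close> and \<open>a\<close> into reach; the reflected
  point \<open>2p - a\<close> makes \<open>p\<close> such an intermediate point.
\<close>

lemma bceh_line_meets:
  assumes "bceh E" and "v \<noteq> 0" and "v \<in> recession_cone E" and "E \<noteq> {}"
  shows "\<exists>t. p + t *\<^sub>R v \<in> E"
proof (rule ccontr)
  assume none: "\<nexists>t. p + t *\<^sub>R v \<in> E"
  obtain a where a: "a \<in> E" using assms(4) by blast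
  let ?q = "2 *\<^sub>R p - a"
  have "bounded (convex hull (E \<union> {?q}) - E)"
    using assms(1) compact_sing convex_singleton unfolding bceh_def by blast
  then obtain B where B: "\<And>x. x \<in> convex hull (E \<union> {?q}) - E \<Longrightarrow> norm x \<le> B"
    unfolding bounded_iff by blast
  have bound: "norm (p + t *\<^sub>R v) \<le> B" if t: "0 \<le> t" for t
  proof (rule B)
    have "a + (2 * t) *\<^sub>R v \<in> E"
      using recession_coneD[OF assms(3) a] t by simp
    then have "(1/2) *\<^sub>R ?q + (1/2) *\<^sub>R (a + (2 * t) *\<^sub>R v) \<in> convex hull (E \<union> {?q})"
      by (intro convexD[OF convex_convex_hull] hull_inc) auto
    moreover have "(1/2) *\<^sub>R ?q + (1/2) *\<^sub>R (a + (2 * t) *\<^sub>R v) = p + t *\<^sub>R v"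
      by (simp add: algebra_simps)
    ultimately show "p + t *\<^sub>R v \<in> convex hull (E \<union> {?q}) - E"
      using none by simp
  qed
  have B0: "0 \<le> B" using order_trans[OF norm_ge_zero bound[OF order_refl]] .
  \<comment> \<open>At this parameter the point is already at distance more than \<open>B\<close> from the origin.\<close>
  let ?t = "(B + norm p + 1) / norm v"
  have "norm (?t *\<^sub>R v) = B + norm p + 1"
    using assms(2) B0 by simp
  moreover have "norm (p + ?t *\<^sub>R v) \<le> B" using bound B0 by simp
  ultimately show False
    using norm_triangle_ineq4[of "p + ?t *\<^sub>R v" p] by simp
qed

text \<open>
  Otherwise \<open>E\<close> is invariant under translation along \<open>v\<close> in both directions; since every line
  parallel to \<open>v\<close> meets \<open>E\<close>, all of them would be contained in \<open>E\<close>.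
\<close>

lemma bceh_recession_cone_pointed:
  assumes "bceh E" and "E \<noteq> {}" and "E \<noteq> UNIV"
    and v: "v \<in> recession_cone E" and mv: "- v \<in> recession_cone E"
  shows "v = 0"
proof (rule ccontr)
  assume "v \<noteq> 0"
  have "p \<in> E" for p
  proof -
    obtain t where t: "p + t *\<^sub>R v \<in> E"
      using bceh_line_meets[OF assms(1) \<open>v \<noteq> 0\<close> v assms(2)] by blast
    show ?thesis
    proof (cases "0 \<le> t")
      case True
      then show ?thesis using recession_coneD[OF mv t True] by simp
    next
      case False
      then show ?thesis using recession_coneD[OF v t, of "- t"] by simp
    qed
  qed
  then show False using assms(3) by blast
qed

lemma affine_line_eq_range:
  assumes "affine_line l" and "a \<in> l" and "a + v \<in> l" and "v \<noteq> 0"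
  shows "l = range (\<lambda>t. a + t *\<^sub>R v)"
proof -
  have "affine hull {a, a + v} = l"
  proof (rule affine_dim_equal)
    show "affine hull {a, a + v} \<subseteq> l"
      using assms unfolding affine_line_def by (simp add: hull_minimal)
    show "aff_dim (affine hull {a, a + v}) = aff_dim l"
      using assms unfolding affine_line_def by (simp add: aff_dim_2)
  qed (use assms in \<open>auto simp: affine_line_def\<close>)
  then show ?thesis by (auto simp: affine_hull_2_alt)
qed

lemma affine_line_parametrization:
  assumes "affine_line l"
  obtains a v where "v \<noteq> 0" and "l = range (\<lambda>t. a + t *\<^sub>R v)"
proof -
  obtain a where a: "a \<in> l"
    using assms unfolding affine_line_def by (metis aff_dim_empty all_not_in_conv neg_equal_iff_equal one_neq_neg_one)
  obtain b where b: "b \<in> l" "b \<noteq> a"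
  proof -
    have "l \<noteq> {a}" using assms unfolding affine_line_def by auto
    then show thesis using a that by blast
  qed
  show thesis
    using affine_line_eq_range[OF assms a, of "b - a"] b that[of "b - a" a] by simp
qed

lemma bceh_no_affine_line:
  assumes "closed E" and "convex E" and "bceh E" and "E \<noteq> UNIV" and "affine_line l"
  shows "\<not> l \<subseteq> E"
proof
  assume sub: "l \<subseteq> E"
  obtain a v where v: "v \<noteq> 0" and l: "l = range (\<lambda>t. a + t *\<^sub>R v)"
    using affine_line_parametrization[OF assms(5)] .
  have "ray a v \<subseteq> E" using sub unfolding l ray_def by blast
  moreover have "ray a (- v) \<subseteq> E"
  proof -
    have "a + t *\<^sub>R - v \<in> range (\<lambda>t. a + t *\<^sub>R v)" for t
      by (rule image_eqI[of _ _ "- t"]) auto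
    then show ?thesis using sub unfolding l ray_def by blast
  qed
  moreover have "E \<noteq> {}" using sub unfolding l by blast
  ultimately show False
    using bceh_recession_cone_pointed[OF assms(3) _ assms(4)] v
      ray_imp_recession_direction[OF assms(1,2)] by blast
qed

section \<open>The set as an epigraph along a recession direction\<close>

definition lower_height :: "'a::real_vector set \<Rightarrow> 'a \<Rightarrow> 'a \<Rightarrow> real" where
  "lower_height E v x = Inf {y. x + y *\<^sub>R v \<in> E}"

text \<open>
  The parameters of the points of \<open>E\<close> on the line through \<open>x\<close> form a set that is upward closed since
  \<open>v\<close> is a recession direction, nonempty by BCEH, bounded below since the recession cone is pointed,
  and closed; so it is a half-line that contains its infimum.
\<close>

lemma lower_height_le_iff:
  assumes "closed E" and "convex E" and "bceh E" and "E \<noteq> {}" and "E \<noteq> UNIV"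
    and v: "v \<in> recession_cone E" and "v \<noteq> 0"
  shows "lower_height E v x \<le> y \<longleftrightarrow> x + y *\<^sub>R v \<in> E"
proof -
  let ?Y = "{y. x + y *\<^sub>R v \<in> E}"
  have up: "y' \<in> ?Y" if "y \<in> ?Y" "y \<le> y'" for y y'
    using recession_coneD[OF v, of "x + y *\<^sub>R v" "y' - y"] that
    by (simp add: algebra_simps)
  have ne: "?Y \<noteq> {}"
    using bceh_line_meets[OF assms(3) assms(7) v assms(4)] by blast
  have bdd: "bdd_below ?Y"
  proof (rule ccontr)
    assume nb: "\<not> bdd_below ?Y"
    have all: "y \<in> ?Y" for y
    proof -
      have "\<exists>y'\<in>?Y. y' < y" using nb unfolding bdd_below_def by (meson not_le)
      then show ?thesis using up less_imp_le by blast
    qed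
    have "ray x (- v) \<subseteq> E"
      unfolding ray_def using all[of "- t" for t] by auto
    then show False
      using bceh_recession_cone_pointed[OF assms(3,4,5) v]
        ray_imp_recession_direction[OF assms(1,2)] assms(7) by blast
  qed
  have "closed ((\<lambda>y. x + y *\<^sub>R v) -` E)"
    by (intro continuous_closed_vimage assms continuous_intros)
  then have "closed ?Y" by (simp add: vimage_def)
  then have "Inf ?Y \<in> ?Y" by (rule closed_contains_Inf[OF ne bdd])
  then show ?thesis
    unfolding lower_height_def using up cInf_lower[OF _ bdd] by blast
qed

lemma lower_height_convex:
  assumes "closed E" and "convex E" and "bceh E" and "E \<noteq> {}" and "E \<noteq> UNIV"
    and "v \<in> recession_cone E" and "v \<noteq> 0"
  shows "convex_on UNIV (lower_height E v)"
proof (rule convex_onI)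
  note iff = lower_height_le_iff[OF assms]
  fix t x y assume t: "0 < (t::real)" "t < 1"
  let ?h = "lower_height E v"
  have "(1 - t) *\<^sub>R (x + ?h x *\<^sub>R v) + t *\<^sub>R (y + ?h y *\<^sub>R v) \<in> E"
    using t iff[of x "?h x"] iff[of y "?h y"] by (intro convexD[OF assms(2)]) auto
  moreover have "(1 - t) *\<^sub>R (x + ?h x *\<^sub>R v) + t *\<^sub>R (y + ?h y *\<^sub>R v)
      = ((1 - t) *\<^sub>R x + t *\<^sub>R y) + ((1 - t) * ?h x + t * ?h y) *\<^sub>R v"
    by (simp add: algebra_simps)
  ultimately show "?h ((1 - t) *\<^sub>R x + t *\<^sub>R y) \<le> (1 - t) * ?h x + t * ?h y"
    using iff by simp
qed simp

text \<open>
  The directions of \<open>l\<close> are multiples of \<open>v\<close>, and the directions of \<open>H\<close> already form the subspace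
  \<open>H - h\<close>; transversality says that these two subspaces together span the whole space.
\<close>

lemma transverse_decomposition:
  assumes "affine H" and "h \<in> H" and "l = range (\<lambda>t. a + t *\<^sub>R v)" and "transverse l H"
  obtains x y where "x \<in> H" and "z = x + y *\<^sub>R v"
proof -
  let ?A = "{p - q | p q. p \<in> l \<and> q \<in> l}" and ?D = "{p - q | p q. p \<in> H \<and> q \<in> H}"
  let ?V = "(\<lambda>x. x - h) ` H"
  have "?A \<subseteq> span {v}"
    unfolding assms(3) by (auto simp: span_singleton scaleR_left_diff_distrib[symmetric])
  then have A: "span ?A \<subseteq> span {v}" by (simp add: span_minimal)
  have "subspace ?V" using affine_diffs_subspace_subtract assms(1,2) by blast
  moreover have "?D \<subseteq> ?V"
  proof
    fix d assume "d \<in> ?D"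
    then obtain p q where "d = p - q" "p \<in> H" "q \<in> H" by blast
    then show "d \<in> ?V"
      using mem_affine_3_minus[OF assms(1) assms(2), of p q 1]
      by (intro image_eqI[of _ _ "h + 1 *\<^sub>R (p - q)"]) auto
  qed
  ultimately have D: "span ?D \<subseteq> ?V" by (simp add: span_minimal)
  have "z - h \<in> span (?A \<union> ?D)" using assms(4) unfolding transverse_def by simp
  then obtain b c where "b \<in> span ?A" "c \<in> span ?D" "z - h = b + c"
    unfolding span_Un by blast
  moreover from this obtain y where "b = y *\<^sub>R v" using A by (auto simp: span_singleton)
  moreover from calculation obtain x where "x \<in> H" "c = x - h" using D by blast
  ultimately show thesis using that[of x y] by (simp add: algebra_simps)
qed

lemma bceh_epigraph_on:
  assumes "closed E" and "convex E" and "bceh E" and "E \<noteq> UNIV"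
    and "affine_line l" and "v \<noteq> 0" and "l \<inter> E = ray a v"
    and "affine_hyperplane H" and "transverse l H"
  shows "epigraph_on H v E"
proof -
  have ray: "ray a v \<subseteq> E" "ray a v \<subseteq> l" using assms(7) by auto
  then have v: "v \<in> recession_cone E"
    using ray_imp_recession_direction[OF assms(1,2)] by blast
  have mem: "a \<in> ray a v" "a + v \<in> ray a v"
    unfolding ray_def by (auto intro: exI[of _ 0] exI[of _ 1])
  have l: "l = range (\<lambda>t. a + t *\<^sub>R v)"
    using affine_line_eq_range assms(5,6) mem ray by blast
  have "E \<noteq> {}" using mem ray by blast
  note conv = lower_height_convex[OF assms(1-3) this assms(4) v assms(6)]
    and iff = lower_height_le_iff[OF assms(1-3) this assms(4) v assms(6)]
  have H: "affine H" using assms(8) unfolding affine_hyperplane_def by blast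
  have "H \<noteq> {}"
    using assms(8) DIM_positive[where 'a='a] aff_dim_empty[of H]
    unfolding affine_hyperplane_def by linarith
  then obtain h where h: "h \<in> H" by blast
  have "convex_on H (lower_height E v)"
    using convex_on_subset[OF conv] affine_imp_convex[OF H] by blast
  moreover have "E = {x + y *\<^sub>R v | x y. x \<in> H \<and> lower_height E v x \<le> y}"
  proof
    show "E \<subseteq> {x + y *\<^sub>R v | x y. x \<in> H \<and> lower_height E v x \<le> y}"
    proof
      fix z assume z: "z \<in> E"
      obtain x y where "x \<in> H" "z = x + y *\<^sub>R v"
        using transverse_decomposition[OF H h l assms(9)] .
      then show "z \<in> {x + y *\<^sub>R v | x y. x \<in> H \<and> lower_height E v x \<le> y}"
        using z iff by blast
    qed
  qed (use iff in auto)
  ultimately show ?thesis unfolding epigraph_on_def by blast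
qed

section \<open>Linear growth\<close>

text \<open>
  In a pointed cone two nonzero vectors never add up to \<open>0\<close>, so the cone without its apex is
  convex. It therefore contains the convex hull of the compact set of its unit vectors, and this
  compact hull can be separated from the origin.
\<close>

lemma recession_cone_positive_functional:
  fixes E :: "'a::euclidean_space set"
  assumes "closed E"
    and pointed: "\<And>v. v \<in> recession_cone E \<Longrightarrow> - v \<in> recession_cone E \<Longrightarrow> v = 0"
  obtains u b where "0 < b" and "\<And>d. d \<in> recession_cone E \<Longrightarrow> norm d = 1 \<Longrightarrow> b < u \<bullet> d"
proof -
  let ?C = "recession_cone E"
  let ?B = "?C \<inter> sphere 0 1"
  have "convex (?C - {0})"
    unfolding convex_alt
  proof (intro ballI allI impI)
    fix x y t assume x: "x \<in> ?C - {0}" and y: "y \<in> ?C - {0}" and t: "0 \<le> (t::real) \<and> t \<le> 1"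
    have tx: "(1 - t) *\<^sub>R x \<in> ?C" and ty: "t *\<^sub>R y \<in> ?C"
      using x y t by (auto intro: recession_cone_scaleR)
    have "(1 - t) *\<^sub>R x + t *\<^sub>R y \<noteq> 0"
    proof
      assume z: "(1 - t) *\<^sub>R x + t *\<^sub>R y = 0"
      then have "- ((1 - t) *\<^sub>R x) = t *\<^sub>R y" by (simp add: add_eq_0_iff)
      then have "(1 - t) *\<^sub>R x = 0" using pointed[OF tx] ty by simp
      moreover from this have "t *\<^sub>R y = 0" using z by (simp only: add_0)
      ultimately show False using x y by auto
    qed
    then show "(1 - t) *\<^sub>R x + t *\<^sub>R y \<in> ?C - {0}"
      using recession_cone_add[OF tx ty] by simp
  qed
  then have "convex hull ?B \<subseteq> ?C - {0}" by (intro hull_minimal) auto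
  then have "0 \<notin> convex hull ?B" by blast
  moreover have "compact ?B"
    using closed_recession_cone[OF assms(1)] by (intro closed_Int_compact) auto
  then have "closed (convex hull ?B)"
    by (intro compact_imp_closed compact_convex_hull)
  ultimately obtain u b where "0 < b" "\<And>x. x \<in> convex hull ?B \<Longrightarrow> b < u \<bullet> x"
    using separating_hyperplane_closed_0[of "convex hull ?B"] by auto
  then show thesis using that[of b u] by (simp add: hull_inc)
qed

text \<open>
  The points of \<open>E\<close> with \<open>u \<bullet> z < b |z|\<close> must be bounded, since otherwise their directions would
  accumulate at a unit recession direction \<open>d\<close> with \<open>u \<bullet> d \<le> b\<close>. The constant \<open>C\<close> absorbs
  this bounded exceptional part.
\<close>

lemma linear_growth_of_positive_functional:
  fixes E :: "'a::euclidean_space set"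
  assumes "closed E" and "convex E" and "0 < b"
    and pos: "\<And>d. d \<in> recession_cone E \<Longrightarrow> norm d = 1 \<Longrightarrow> b < u \<bullet> d"
  obtains C where "0 \<le> C" and "\<And>z. z \<in> E \<Longrightarrow> b * norm z - C \<le> u \<bullet> z"
proof -
  let ?S = "{z \<in> E. u \<bullet> z < b * norm z}"
  have "bounded ?S"
  proof (rule ccontr)
    assume "\<not> bounded ?S"
    then obtain d where d: "d \<in> recession_cone E" "norm d = 1"
      "d \<in> closure ((\<lambda>z. z /\<^sub>R norm z) ` ?S)"
      using unbounded_subset_recession_direction[OF assms(1,2), of ?S] by blast
    have "(\<lambda>z. z /\<^sub>R norm z) ` ?S \<subseteq> {x. u \<bullet> x \<le> b}"
    proof clarify
      fix z assume "u \<bullet> z < b * norm z"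
      moreover from this have "z \<noteq> 0" by auto
      ultimately show "u \<bullet> (z /\<^sub>R norm z) \<le> b" by (simp add: field_simps)
    qed
    then have "closure ((\<lambda>z. z /\<^sub>R norm z) ` ?S) \<subseteq> {x. u \<bullet> x \<le> b}"
      by (intro closure_minimal closed_halfspace_le)
    then show False using d pos by force
  qed
  then obtain M where M: "0 < M" "\<And>z. z \<in> ?S \<Longrightarrow> norm z \<le> M"
    unfolding bounded_pos by blast
  show thesis
  proof (rule that[of "(b + norm u) * M"])
    show "0 \<le> (b + norm u) * M" using M assms(3) by simp
    fix z assume z: "z \<in> E"
    show "b * norm z - (b + norm u) * M \<le> u \<bullet> z"
    proof (cases "u \<bullet> z < b * norm z")
      case True
      then have "norm z \<le> M" using M z by blast
      then have "(b + norm u) * norm z \<le> (b + norm u) * M"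
        using assms(3) by (intro mult_left_mono) auto
      moreover have "- (norm u * norm z) \<le> u \<bullet> z"
        using Cauchy_Schwarz_ineq2[of u z] by linarith
      ultimately show ?thesis by (simp add: algebra_simps)
    next
      case False
      moreover have "0 \<le> (b + norm u) * M" using M assms(3) by simp
      ultimately show ?thesis by linarith
    qed
  qed
qed

lemma liminf_slope_pos:
  assumes "0 < m" and "\<And>x. x \<in> S \<Longrightarrow> m * norm x - D \<le> \<phi> x"
  shows "0 < liminf_slope S \<phi>"
proof -
  \<comment> \<open>Beyond \<open>2 * D / m\<close> half of the slope compensates \<open>D\<close>; the bound \<open>1\<close> keeps \<open>x\<close> away from \<open>0\<close>.\<close>
  let ?R = "max 1 (2 * D / m)"
  have "ereal (m / 2) \<le> ereal (\<phi> x / norm x)" if x: "x \<in> S" and R: "?R \<le> norm x" for x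
  proof -
    have "2 * D / m \<le> norm x" using R by simp
    then have "2 * D \<le> norm x * m" by (simp only: pos_divide_le_eq[OF assms(1)])
    then have "m / 2 * norm x \<le> \<phi> x"
      using assms(2)[OF x] by (simp add: mult.commute[of m])
    moreover have "0 < norm x" using R by linarith
    ultimately show ?thesis by (simp only: ereal_less_eq pos_le_divide_eq)
  qed
  then have "\<forall>\<^sub>F x in inf at_infinity (principal S). ereal (m / 2) \<le> ereal (\<phi> x / norm x)"
    unfolding eventually_inf_principal eventually_at_infinity by blast
  then have "ereal (m / 2) \<le> liminf_slope S \<phi>"
    unfolding liminf_slope_def by (rule Liminf_bounded)
  then show ?thesis using assms(1) by (auto intro: less_le_trans[of _ "ereal (m / 2)"])
qed

text \<open>
  The map \<open>z \<mapsto> z - (u \<bullet> z) v\<close> is the projection along \<open>v\<close> onto the orthogonal complement of \<open>u\<close>,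
  and the orthogonal map \<open>g\<close> carries this complement isometrically to the coordinate hyperplane.
\<close>

lemma affine_coordinates_along:
  fixes u v :: "real ^ 'n::finite"
  assumes "orthogonal_transformation g" and gu: "g u = norm u *\<^sub>R axis k 1" and uv: "u \<bullet> v = 1"
  shows "affine_coordinates k (\<lambda>z. (g (z - (u \<bullet> z) *\<^sub>R v), u \<bullet> z + c))"
proof -
  let ?T = "\<lambda>z. (g (z - (u \<bullet> z) *\<^sub>R v), u \<bullet> z + c)"
  let ?L = "\<lambda>z. (g (z - (u \<bullet> z) *\<^sub>R v), u \<bullet> z)"
  have g: "linear g" using assms(1) by (rule orthogonal_transformation_linear)
  have u0: "norm u > 0" using uv by auto
  have coord: "norm u * (g w $ k) = u \<bullet> w" for w
  proof -
    have "u \<bullet> w = g u \<bullet> g w" using assms(1) by (simp add: orthogonal_transformation_def)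
    then show ?thesis unfolding gu by (simp add: inner_axis' )
  qed
  have "linear ?L"
    by (rule linearI) (simp_all add: linear_add[OF g] linear_diff[OF g] linear_cmul[OF g]
        inner_add_right algebra_simps)
  moreover have "?T = (\<lambda>z. (0, c) + ?L z)" by auto
  moreover have "bij_betw ?T UNIV (coord_hyperplane k \<times> UNIV)"
  proof (rule bij_betwI[where g = "\<lambda>(x, y). inv g x + (y - c) *\<^sub>R v"])
    show "?T \<in> UNIV \<rightarrow> coord_hyperplane k \<times> UNIV"
    proof
      fix z
      have "norm u * (g (z - (u \<bullet> z) *\<^sub>R v) $ k) = 0"
        unfolding coord by (simp add: inner_diff_right uv)
      then show "?T z \<in> coord_hyperplane k \<times> UNIV"
        using u0 unfolding coord_hyperplane_def by auto
    qed
    have inv: "inv g (g x) = x" "g (inv g x) = x" for x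
      using orthogonal_transformation_bij[OF assms(1)]
      by (simp_all add: bij_is_inj bij_is_surj surj_f_inv_f)
    show "(case ?T z of (x, y) \<Rightarrow> inv g x + (y - c) *\<^sub>R v) = z" for z
      by (simp add: inv)
    show "?T (case p of (x, y) \<Rightarrow> inv g x + (y - c) *\<^sub>R v) = p"
      if mem: "p \<in> coord_hyperplane k \<times> UNIV" for p
    proof -
      obtain x y where p: "p = (x, y)" "x $ k = 0"
        using mem unfolding coord_hyperplane_def by auto
      have "u \<bullet> inv g x = 0" using coord[of "inv g x"] p by (simp add: inv)
      then show ?thesis by (simp add: p inner_add_right uv inv)
    qed
  qed simp
  ultimately show ?thesis unfolding affine_coordinates_def by blast
qed

lemma bceh_coordinates:
  fixes E :: "(real ^ 'n::finite) set"
  assumes "E \<noteq> UNIV" and "closed E" and "convex E" and "\<not> bounded E" and "bceh E"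
  shows "\<exists>T \<phi>. affine_coordinates k T \<and>
       T ` E = epigraph (coord_hyperplane k) \<phi> \<and>
       convex_on (coord_hyperplane k) \<phi> \<and>
       (\<forall>x \<in> coord_hyperplane k. 0 \<le> \<phi> x) \<and>
       0 < liminf_slope (coord_hyperplane k) \<phi>"
proof -
  have ne: "E \<noteq> {}" using assms(4) by auto
  obtain u b where b: "0 < b"
    and pos: "\<And>d. d \<in> recession_cone E \<Longrightarrow> norm d = 1 \<Longrightarrow> b < u \<bullet> d"
    using recession_cone_positive_functional[OF assms(2)]
      bceh_recession_cone_pointed[OF assms(5) ne assms(1)] by metis
  obtain C where C: "0 \<le> C" and growth: "\<And>z. z \<in> E \<Longrightarrow> b * norm z - C \<le> u \<bullet> z"
    using linear_growth_of_positive_functional[OF assms(2,3) b pos] by blast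
  obtain d where d: "d \<in> recession_cone E" "norm d = 1"
    using unbounded_subset_recession_direction[OF assms(2,3) order_refl assms(4)] by blast
  \<comment> \<open>Normalised so that moving by \<open>y *\<^sub>R v\<close> raises \<open>u \<bullet> z\<close> by exactly \<open>y\<close>.\<close>
  define v where "v = (1 / (u \<bullet> d)) *\<^sub>R d"
  have ud: "0 < u \<bullet> d" using pos[OF d] b by linarith
  then have uv: "u \<bullet> v = 1" and v: "v \<in> recession_cone E"
    unfolding v_def using d by (auto intro: recession_cone_scaleR)
  then have v0: "v \<noteq> 0" by auto
  note conv = lower_height_convex[OF assms(2,3,5) ne assms(1) v v0]
    and iff = lower_height_le_iff[OF assms(2,3,5) ne assms(1) v v0]
  have "norm u = norm (norm u *\<^sub>R (axis k 1 :: real ^ 'n))" by simp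
  then obtain g :: "real ^ 'n \<Rightarrow> real ^ 'n"
    where g: "orthogonal_transformation g" and gu: "g u = norm u *\<^sub>R axis k 1"
    by (rule orthogonal_transformation_exists)
  define T where "T z = (g (z - (u \<bullet> z) *\<^sub>R v), u \<bullet> z + C)" for z
  define \<phi> where "\<phi> x = lower_height E v (inv g x) + C" for x
  have T: "affine_coordinates k T"
    unfolding T_def[abs_def] using affine_coordinates_along[OF g gu uv] .
  have inv: "inv g (g x) = x" for x
    using orthogonal_transformation_bij[OF g] by (simp add: bij_is_inj)
  have iffT: "\<phi> (fst (T z)) \<le> snd (T z) \<longleftrightarrow> z \<in> E" for z
    using iff[of "z - (u \<bullet> z) *\<^sub>R v" "u \<bullet> z"] by (simp add: T_def \<phi>_def inv)
  have range: "range T = coord_hyperplane k \<times> UNIV"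
    using T unfolding affine_coordinates_def bij_betw_def by blast
  have epi: "T ` E = epigraph (coord_hyperplane k) \<phi>"
  proof
    show "T ` E \<subseteq> epigraph (coord_hyperplane k) \<phi>"
    proof
      fix p assume "p \<in> T ` E"
      then obtain z where z: "z \<in> E" "p = T z" by blast
      moreover have "T z \<in> coord_hyperplane k \<times> UNIV" using range by blast
      ultimately show "p \<in> epigraph (coord_hyperplane k) \<phi>"
        using iffT unfolding epigraph_def by (simp add: mem_Times_iff)
    qed
    show "epigraph (coord_hyperplane k) \<phi> \<subseteq> T ` E"
    proof
      fix p assume p: "p \<in> epigraph (coord_hyperplane k) \<phi>"
      then have "p \<in> coord_hyperplane k \<times> UNIV"
        unfolding epigraph_def by (auto simp: mem_Times_iff)
      then obtain z where "p = T z" using range by blast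
      then show "p \<in> T ` E" using p iffT unfolding epigraph_def by auto
    qed
  qed
  have lin: "linear (inv g)"
    using orthogonal_transformation_inv[OF g] by (rule orthogonal_transformation_linear)
  have cH: "convex (coord_hyperplane k :: (real ^ 'n) set)"
    unfolding coord_hyperplane_def convex_def by simp
  have cphi: "convex_on (coord_hyperplane k) \<phi>"
  proof (rule convex_onI)
    fix t x y assume t: "0 < (t::real)" "t < 1"
    have "inv g ((1 - t) *\<^sub>R x + t *\<^sub>R y) = (1 - t) *\<^sub>R inv g x + t *\<^sub>R inv g y"
      by (simp only: linear_add[OF lin] linear_cmul[OF lin])
    then have "\<phi> ((1 - t) *\<^sub>R x + t *\<^sub>R y)
        \<le> (1 - t) * lower_height E v (inv g x) + t * lower_height E v (inv g y) + C"
      using convex_onD[OF conv, of t "inv g x" "inv g y"] t by (simp add: \<phi>_def)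
    also have "\<dots> = (1 - t) * \<phi> x + t * \<phi> y"
      by (simp add: \<phi>_def algebra_simps)
    finally show "\<phi> ((1 - t) *\<^sub>R x + t *\<^sub>R y) \<le> (1 - t) * \<phi> x + t * \<phi> y" .
  qed (rule cH)
  \<comment> \<open>The growth bound controls \<open>|z|\<close>, whereas the slope concerns the projection \<open>x\<close> of \<open>z\<close> along \<open>v\<close>,
    which may be longer by up to \<open>(\<phi> x + C) * norm v\<close>. Solving the resulting inequality
    \<open>b * norm x \<le> \<phi> x + b * (\<phi> x + C) * norm v\<close> for \<open>\<phi> x\<close> gives these two constants.\<close>
  let ?m = "b / (1 + b * norm v)" and ?D = "b * C * norm v / (1 + b * norm v)"
  have est: "0 \<le> \<phi> x \<and> ?m * norm x - ?D \<le> \<phi> x" if x: "x \<in> coord_hyperplane k" for x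
  proof -
    have "(x, \<phi> x) \<in> T ` E" unfolding epi epigraph_def using x by simp
    then obtain z where z: "z \<in> E" and xz: "x = g (z - (u \<bullet> z) *\<^sub>R v)" and pz: "\<phi> x = u \<bullet> z + C"
      unfolding T_def by auto
    have low: "b * norm z \<le> \<phi> x" using growth[OF z] pz by linarith
    then have nonneg: "0 \<le> \<phi> x" using b by (meson mult_nonneg_nonneg less_imp_le norm_ge_zero order_trans)
    have "norm x = norm (z - (u \<bullet> z) *\<^sub>R v)"
      using g unfolding xz by (simp add: orthogonal_transformation_norm)
    also have "\<dots> \<le> norm z + \<bar>u \<bullet> z\<bar> * norm v"
      using norm_triangle_ineq4[of z "(u \<bullet> z) *\<^sub>R v"] by simp
    also have "\<dots> \<le> norm z + (\<phi> x + C) * norm v"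
      using nonneg pz C by (intro add_left_mono mult_right_mono) auto
    finally have "b * norm x \<le> b * (norm z + (\<phi> x + C) * norm v)"
      using b by simp
    then have "b * norm x - b * C * norm v \<le> \<phi> x * (1 + b * norm v)"
      using low by (simp add: algebra_simps)
    moreover have "0 < 1 + b * norm v" using b by (simp add: add_pos_nonneg)
    ultimately have "?m * norm x - ?D \<le> \<phi> x"
      by (simp add: diff_divide_distrib[symmetric] pos_divide_le_eq)
    then show ?thesis using nonneg by blast
  qed
  have "0 < ?m" using b by (simp add: add_pos_nonneg)
  then have "0 < liminf_slope (coord_hyperplane k) \<phi>"
    by (rule liminf_slope_pos) (use est in blast)
  then show ?thesis using T epi cphi est by blast
qed

theorem proposition3p4:
  fixes E :: "(real ^ 'n::finite) set" and k :: 'n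
  assumes "E \<noteq> UNIV" and "closed E" and "convex E" and "\<not> bounded E" and "bceh E"
  shows "(\<not> (\<exists>l. affine_line l \<and> l \<subseteq> E)) \<and>
    (\<forall>l H a v. affine_line l \<and> v \<noteq> 0 \<and> l \<inter> E = ray a v \<and> affine_hyperplane H \<and> transverse l H
       \<longrightarrow> epigraph_on H v E) \<and>
    (\<exists>T \<phi>. affine_coordinates k T \<and>
       T ` E = epigraph (coord_hyperplane k) \<phi> \<and>
       convex_on (coord_hyperplane k) \<phi> \<and>
       (\<forall>x \<in> coord_hyperplane k. 0 \<le> \<phi> x) \<and>
       0 < liminf_slope (coord_hyperplane k) \<phi>)"
  using bceh_no_affine_line[OF assms(2,3,5,1)] bceh_epigraph_on[OF assms(2,3,5,1)]
    bceh_coordinates[OF assms] by blast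

end
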